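(* Let $d\ge 1$ be an integer and let $S\subset\mathbb{Z}^{d}$ be a finite set with $0\notin S$ and $-S=S$. Let $$f(x)=\sum_{\lambda\in S}c(\lambda)\exp\bigl(2\pi i\langle x,\lambda\rangle\bigr),\qquad c(\lambda)\in\mathbb{C},$$ be a real-valued trigonometric polynomial on the torus $\mathbb{T}^{d}=\mathbb{R}^{d}/\mathbb{Z}^{d}$. Then $f$ has a zero in every closed ball of diameter $D(S)$, where $$D(S):=\sum_{\lambda\in S}\frac{1}{4\|\lambda\|_{2}},\qquad \|\lambda\|_{2}=\sqrt{\langle\lambda,\lambda\rangle}=\sqrt{\sum_{j=1}^{d}\lambda_{j}^{2}}.$$
   Context: $\langle\cdot,\cdot\rangle$ is the standard inner product on $\mathbb{R}^d$. Balls are Euclidean: a closed ball of diameter $D$ in $\mathbb{T}^d$ is the image in $\mathbb{R}^d/\mathbb{Z}^d$ of a closed Euclidean ball of radius $D/2$ in $\mathbb{R}^d$ (equivalently, regard $f$ as a $\mathbb{Z}^d$-periodic function on $\mathbb{R}^d$ and take closed Euclidean balls of radius $D/2$ in $\mathbb{R}^d$). *)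

theory Defs
  imports "HOL-Analysis.Analysis"
begin

definition real_vec :: "int ^ 'n \<Rightarrow> real ^ 'n" where
  "real_vec v = (\<chi> j. real_of_int (v $ j))"

text \<open>
  Functions on the torus are represented by their periodic lifts to Euclidean space;
  a trigonometric polynomial with integer frequencies is periodic under integer translations.
\<close>

definition trig_poly :: "(int ^ 'n) set \<Rightarrow> (int ^ 'n \<Rightarrow> complex) \<Rightarrow> real ^ 'n \<Rightarrow> complex" where
  "trig_poly S c x =
     (\<Sum>v\<in>S. c v * exp (2 * complex_of_real pi * \<i> * complex_of_real (x \<bullet> real_vec v)))"

definition zero_diameter :: "(int ^ 'n) set \<Rightarrow> real" where
  "zero_diameter S = (\<Sum>v\<in>S. 1 / (4 * norm (real_vec v)))"

end

theory Submission
  imports Defs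
begin

text \<open>
  The idea is to average \<open>f\<close> over small translations that annihilate one pair of frequencies at
  a time.  For \<open>v \<in> S\<close> put \<open>w = v / (4 |v|\<^sup>2)\<close>.  The symmetric average
  \<open>h x = (f (x + w) + f (x - w)) / 2\<close> multiplies the coefficient at a frequency \<open>u\<close> by
  \<open>cos (2\<pi> \<langle>w, u\<rangle>)\<close> (lemma \<open>trig_poly_symmetric_average\<close>), and this factor vanishes at
  \<open>u = v\<close> and \<open>u = -v\<close>, where \<open>\<langle>w, u\<rangle> = 1/4\<close> or \<open>-1/4\<close>.  So \<open>h\<close> is again a real trigonometric
  polynomial, with spectrum in \<open>S - {v, -v}\<close>.  If \<open>h y \<le> 0\<close>, then \<open>f \<le> 0\<close> at one of the points
  \<open>y + w\<close>, \<open>y - w\<close>, which lie at distance \<open>1 / (4 |v|)\<close> from \<open>y\<close>; this is exactly the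
  contribution of the pair \<open>v, -v\<close> to half the zero diameter.  Induction on the number of
  frequencies therefore yields a point with \<open>f \<le> 0\<close> in every closed ball of diameter
  \<open>zero_diameter S\<close> (lemma \<open>trig_poly_nonpos_in_cball\<close>).  The same result for \<open>-f\<close> gives a point
  with \<open>f \<ge> 0\<close>, and the intermediate value theorem on the ball, which is connected, gives a zero.
\<close>

lemma real_vec_minus [simp]: "real_vec (- v) = - real_vec v"
  by (simp add: real_vec_def vec_eq_iff)

lemma real_vec_eq_0_iff [simp]: "real_vec v = 0 \<longleftrightarrow> v = 0"
  by (simp add: real_vec_def vec_eq_iff)

lemma continuous_on_trig_poly: "continuous_on A (trig_poly S c)"
  unfolding trig_poly_def by (intro continuous_intros)

lemma trig_poly_uminus: "trig_poly S (\<lambda>v. - c v) x = - trig_poly S c x"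
  by (simp add: trig_poly_def sum_negf)

lemma trig_poly_symmetric_average:
  "(trig_poly S c (x + w) + trig_poly S c (x - w)) / 2
     = trig_poly S (\<lambda>v. c v * complex_of_real (cos (2 * pi * (w \<bullet> real_vec v)))) x"
proof -
  have "(exp (2 * complex_of_real pi * \<i> * complex_of_real ((x + w) \<bullet> u))
       + exp (2 * complex_of_real pi * \<i> * complex_of_real ((x - w) \<bullet> u))) / 2
     = complex_of_real (cos (2 * pi * (w \<bullet> u)))
       * exp (2 * complex_of_real pi * \<i> * complex_of_real (x \<bullet> u))" for u
  proof -
    define X where "X = 2 * complex_of_real pi * \<i> * complex_of_real (x \<bullet> u)"
    define W where "W = \<i> * complex_of_real (2 * pi * (w \<bullet> u))"
    have "2 * complex_of_real pi * \<i> * complex_of_real ((x + w) \<bullet> u) = X + W"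
      by (simp add: X_def W_def inner_add_left distrib_left)
    moreover have "2 * complex_of_real pi * \<i> * complex_of_real ((x - w) \<bullet> u) = X + - W"
      by (simp add: X_def W_def inner_diff_left right_diff_distrib)
    moreover have "complex_of_real (cos (2 * pi * (w \<bullet> u))) = (exp W + exp (- W)) / 2"
      unfolding W_def cos_of_real[symmetric] cos_exp_eq by (simp only: mult_minus_left)
    ultimately show ?thesis
      by (simp only: X_def[symmetric] exp_add) (simp add: distrib_left mult.commute)
  qed
  then have "(c v * exp (2 * complex_of_real pi * \<i> * complex_of_real ((x + w) \<bullet> real_vec v))
       + c v * exp (2 * complex_of_real pi * \<i> * complex_of_real ((x - w) \<bullet> real_vec v))) / 2
     = c v * complex_of_real (cos (2 * pi * (w \<bullet> real_vec v)))
       * exp (2 * complex_of_real pi * \<i> * complex_of_real (x \<bullet> real_vec v))" for v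
    by (simp only: distrib_left[symmetric] times_divide_eq_right[symmetric] mult.assoc)
  then show ?thesis
    by (simp add: trig_poly_def sum.distrib[symmetric] sum_divide_distrib)
qed

lemma trig_poly_nonpos_in_cball:
  fixes S :: "(int ^ 'n) set" and g :: "real ^ 'n \<Rightarrow> real"
  assumes "finite S" and "0 \<notin> S" and "uminus ` S = S"
    and "\<And>x. complex_of_real (g x) = trig_poly S c x"
  shows "\<exists>x \<in> cball a (zero_diameter S / 2). g x \<le> 0"
  using assms
proof (induction "card S" arbitrary: S c g rule: less_induct)
  case less
  show ?case
  proof (cases "S = {}")
    case True
    then have "g a = 0"
      using less.prems(4)[of a] by (simp add: trig_poly_def)
    then show ?thesis
      using True by (intro bexI[of _ a]) (auto simp: zero_diameter_def)
  next
    case False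
    then obtain v where v: "v \<in> S" by blast
    have mv: "- v \<in> S" using v less.prems(3) by blast
    have v0: "v \<noteq> 0" using v less.prems(2) by blast
    have vmv: "v \<noteq> - v"
    proof
      assume "v = - v"
      then have "\<forall>j. v $ j = 0" by (auto simp: vec_eq_iff)
      then show False using v0 by (simp add: vec_eq_iff)
    qed
    define T where "T = S - {v, - v}"
    define w where "w = (1 / (4 * (norm (real_vec v))\<^sup>2)) *\<^sub>R real_vec v"
    define h where "h = (\<lambda>x. (g (x + w) + g (x - w)) / 2)"
    define c' where "c' = (\<lambda>u. c u * complex_of_real (cos (2 * pi * (w \<bullet> real_vec u))))"
    have nv: "norm (real_vec v) > 0" using v0 by simp
    have "w \<bullet> real_vec v = 1 / 4"
      using nv v0 by (simp add: w_def power2_norm_eq_inner)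
    then have "2 * pi * (w \<bullet> real_vec v) = pi / 2"
      by simp
    then have "cos (2 * pi * (w \<bullet> real_vec v)) = 0"
      by (simp only: cos_pi_half)
    then have kill: "c' v = 0" "c' (- v) = 0"
      by (simp_all add: c'_def)
    have nw: "norm w = 1 / (4 * norm (real_vec v))"
      using nv by (simp add: w_def power2_eq_square)
    have S_eq: "S = insert v (insert (- v) T)"
      using v mv by (auto simp: T_def)
    have finT: "finite T" using less.prems(1) by (simp add: T_def)
    have notin: "- v \<notin> T" "v \<notin> insert (- v) T"
      using vmv by (auto simp: T_def)
    have hT: "complex_of_real (h x) = trig_poly T c' x" for x
    proof -
      have "complex_of_real (h x) = trig_poly S c' x"
        using trig_poly_symmetric_average[of S c x w] by (simp add: h_def c'_def less.prems(4))
      also have "\<dots> = trig_poly T c' x"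
        unfolding S_eq trig_poly_def using finT notin kill by simp
      finally show ?thesis .
    qed
    have "card T < card S"
      using v less.prems(1) by (auto simp: T_def intro!: psubset_card_mono)
    moreover have "0 \<notin> T" using less.prems(2) by (simp add: T_def)
    moreover have "uminus ` T = T"
    proof -
      have "uminus ` T = uminus ` S - uminus ` {v, - v}"
        unfolding T_def by (rule image_set_diff) (simp add: inj_def)
      then show ?thesis using less.prems(3) by (auto simp: T_def)
    qed
    ultimately obtain y where y: "y \<in> cball a (zero_diameter T / 2)" "h y \<le> 0"
      using less.hyps[of T h c'] finT hT by blast
    have diam: "zero_diameter S / 2 = zero_diameter T / 2 + norm w"
      unfolding S_eq zero_diameter_def nw using finT notin by simp
    have near: "z \<in> cball a (zero_diameter S / 2)" if "dist y z = norm w" for z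
      using y(1) that dist_triangle[of a z y] by (simp add: diam)
    have "y + w \<in> cball a (zero_diameter S / 2)" "y - w \<in> cball a (zero_diameter S / 2)"
      by (rule near, simp add: dist_norm)+
    moreover have "g (y + w) \<le> 0 \<or> g (y - w) \<le> 0"
      using y(2) by (auto simp: h_def)
    ultimately show ?thesis by blast
  qed
qed

theorem theorem1:
  fixes S :: "(int ^ 'n) set" and c :: "int ^ 'n \<Rightarrow> complex" and f :: "real ^ 'n \<Rightarrow> real"
  assumes "finite S" and "0 \<notin> S" and "uminus ` S = S"
    and "\<And>x. complex_of_real (f x) = trig_poly S c x"
  shows "\<forall>a. \<exists>x \<in> cball a (zero_diameter S / 2). f x = 0"
proof
  fix a :: "real ^ 'n"
  let ?B = "cball a (zero_diameter S / 2)"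
  obtain x where x: "x \<in> ?B" "f x \<le> 0"
    using trig_poly_nonpos_in_cball[OF assms] by blast
  have "complex_of_real (- f x) = trig_poly S (\<lambda>v. - c v) x" for x
    by (simp add: trig_poly_uminus assms(4))
  then obtain y where y: "y \<in> ?B" "- f y \<le> 0"
    using trig_poly_nonpos_in_cball[OF assms(1-3), of "\<lambda>x. - f x"] by blast
  have "f = (\<lambda>x. Re (trig_poly S c x))"
    by (metis Re_complex_of_real assms(4))
  then have "continuous_on ?B f"
    by (simp add: continuous_on_Re continuous_on_trig_poly)
  then have "connected (f ` ?B)"
    by (intro connected_continuous_image convex_connected convex_cball)
  then have "0 \<in> f ` ?B"
    using x y by (auto intro: connectedD_interval[of _ "f x" "f y"])
  then show "\<exists>x \<in> ?B. f x = 0"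
    by (metis imageE)
qed

end
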